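(* Let $\alpha$ be irrational. For all integers $k\ge 1$, $$A_k(\alpha) = \max L(2k-2)\cdot A_1(\alpha).$$
   Context: The Sturmian word of slope $\alpha$ and intercept $x\in[0,1)$ has $n$-th letter ($n\ge0$) $0$ if $\{x+n\alpha\}\in[0,\{1-\alpha\})$ and $1$ otherwise (or the analogous left-open convention), $\{\cdot\}$ the fractional part. Two words are $k$-abelian equivalent if every nonempty word of length at most $k$ occurs as a factor equally often in both ($1$-abelian equivalence = same letter counts). A $k$-abelian power of period $m$ and exponent $n$ is a concatenation of $n$ pairwise $k$-abelian equivalent words of length $m$. $\mathrm{ab}_{k,\alpha}(m)$ is the maximum exponent of a $k$-abelian power of period $m$ occurring in a Sturmian word of slope $\alpha$, and the $k$-abelian critical exponent of slope $\alpha$ is $A_k(\alpha)=\limsup_{m\to\infty}\mathrm{ab}_{k,\alpha}(m)/m$ (possibly $+\infty$). For $n\ge0$, the points $0,\{-\alpha\},\ldots,\{-n\alpha\}$ cut the circle $[0,1)$ into $n+1$ intervals (the level $n$ intervals), and $\max L(n)$ is the maximum length of a level $n$ interval (so $\max L(0)=1$). *)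

theory Defs
  imports Complex_Main "HOL-Library.Extended_Real"
begin

definition sturmian_right_open :: "real \<Rightarrow> real \<Rightarrow> nat \<Rightarrow> nat" where
  "sturmian_right_open \<alpha> x n =
     (if frac (x + real n * \<alpha>) \<in> {0..<frac (1 - \<alpha>)} then 0 else 1)"

text \<open>In the left-open coding the point \<open>0\<close> of the circle plays the role of \<open>1\<close>,
  so it receives the letter \<open>1\<close>.\<close>

definition sturmian_left_open :: "real \<Rightarrow> real \<Rightarrow> nat \<Rightarrow> nat" where
  "sturmian_left_open \<alpha> x n =
     (if frac (x + real n * \<alpha>) \<in> {0<..frac (1 - \<alpha>)} then 0 else 1)"

definition sturmian_word :: "real \<Rightarrow> (nat \<Rightarrow> nat) \<Rightarrow> bool" where
  "sturmian_word \<alpha> w \<longleftrightarrow>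
     (\<exists>x\<in>{0..<1}. w = sturmian_right_open \<alpha> x \<or> w = sturmian_left_open \<alpha> x)"

definition occurs_in :: "'a list \<Rightarrow> (nat \<Rightarrow> 'a) \<Rightarrow> bool" where
  "occurs_in u w \<longleftrightarrow> (\<exists>i. u = map w [i..<i + length u])"

definition occurrences :: "'a list \<Rightarrow> 'a list \<Rightarrow> nat" where
  "occurrences u v =
     card {i. i + length u \<le> length v \<and> take (length u) (drop i v) = u}"

definition k_abelian_equiv :: "nat \<Rightarrow> 'a list \<Rightarrow> 'a list \<Rightarrow> bool" where
  "k_abelian_equiv k v w \<longleftrightarrow>
     (\<forall>u. u \<noteq> [] \<and> length u \<le> k \<longrightarrow> occurrences u v = occurrences u w)"

definition k_abelian_power :: "nat \<Rightarrow> nat \<Rightarrow> nat \<Rightarrow> 'a list \<Rightarrow> bool" where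
  "k_abelian_power k m n z \<longleftrightarrow>
     (\<exists>ws. length ws = n \<and> (\<forall>v\<in>set ws. length v = m) \<and>
           (\<forall>v\<in>set ws. \<forall>w\<in>set ws. k_abelian_equiv k v w) \<and> z = concat ws)"

text \<open>The maximum exponent is a supremum in \<open>enat\<close>, which is the maximum whenever the
  exponents are bounded and \<open>\<infinity>\<close> otherwise. The degenerate period \<open>m = 0\<close> gives \<open>\<infinity>\<close>;
  it has no influence on the limit superior below.\<close>

definition ab :: "nat \<Rightarrow> real \<Rightarrow> nat \<Rightarrow> enat" where
  "ab k \<alpha> m =
     (SUP n \<in> {n. \<exists>w z. sturmian_word \<alpha> w \<and> k_abelian_power k m n z \<and> occurs_in z w}. enat n)"

definition abelian_critical_exponent :: "nat \<Rightarrow> real \<Rightarrow> ereal" where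
  "abelian_critical_exponent k \<alpha> = limsup (\<lambda>m. ereal_of_enat (ab k \<alpha> m) / ereal (real m))"

definition level_points :: "real \<Rightarrow> nat \<Rightarrow> real set" where
  "level_points \<alpha> n = (\<lambda>i. frac (- (real i * \<alpha>))) ` {0..n}"

text \<open>An interval is represented by its pair of endpoints. Since \<open>0\<close> is always a cut point,
  no interval wraps around; the last one ends at \<open>1\<close>, which is the point \<open>0\<close> of the circle.\<close>

definition level_intervals :: "real \<Rightarrow> nat \<Rightarrow> (real \<times> real) set" where
  "level_intervals \<alpha> n =
     {(p, q). p \<in> level_points \<alpha> n \<and> q \<in> insert 1 (level_points \<alpha> n) \<and> p < q \<and>
              {p<..<q} \<inter> level_points \<alpha> n = {}}"

definition max_L :: "real \<Rightarrow> nat \<Rightarrow> real" where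
  "max_L \<alpha> n = Max ((\<lambda>(p, q). q - p) ` level_intervals \<alpha> n)"

end

theory Submission
  imports Defs "HOL-Analysis.Extended_Real_Limits"
begin

text \<open>
  Write \<open>m\<alpha> = c + \<epsilon>\<close> with \<open>c\<close> an integer. A \<open>k\<close>-abelian power of period \<open>m\<close> and exponent \<open>n\<close> starting at
  the point \<open>x\<close> of the circle corresponds to the arithmetic progression \<open>x, x + \<epsilon>, \<dots>, x + (n - 1)\<epsilon>\<close>.
  Up to boundary terms its factors are \<open>k\<close>-abelian equivalent iff the progression avoids the
  points \<open>-i\<alpha>\<close> with \<open>\<bar>i\<bar> < k\<close>: positive \<open>i\<close> control the common prefix of length \<open>k - 1\<close>, negative
  \<open>i\<close> the common suffix, and \<open>i = 0\<close> the letter counts. A rotation by \<open>(k - 1)\<alpha>\<close> turns these points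
  into the level \<open>2k - 2\<close> points, so the maximal exponent differs from
  \<open>max L(2k - 2) / \<parallel>m\<alpha>\<parallel>\<close> by at most 2, and only this term survives in the limit superior.
\<close>

section \<open>Occurrences in factors of infinite words\<close>

abbreviation factor :: "(nat \<Rightarrow> 'a) \<Rightarrow> nat \<Rightarrow> nat \<Rightarrow> 'a list" where
  "factor w i m \<equiv> map w [i..<i + m]"

lemma nth_factor: "r < l \<Longrightarrow> factor w i l ! r = w (i + r)"
  by simp

lemma take_drop_factor:
  assumes "s + l \<le> m"
  shows "take l (drop s (factor w i m)) = factor w (i + s) l"
  using assms by (intro nth_equalityI) (auto simp: add.assoc)

lemma occurrences_factor:
  assumes "u \<noteq> []"
  shows "occurrences u (factor w i m) =
         (\<Sum>s<m + 1 - length u. of_bool (factor w (i + s) (length u) = u))"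
proof -
  have "{s. s + length u \<le> length (factor w i m) \<and>
            take (length u) (drop s (factor w i m)) = u} =
        {s \<in> {..<m + 1 - length u}. factor w (i + s) (length u) = u}"
    using take_drop_factor[of _ "length u" m w i] by (auto simp: less_diff_conv)
  then show ?thesis
    unfolding occurrences_def by (simp add: sum.If_cases of_bool_def Int_def)
qed

lemma factor_Suc_left: "factor w t (Suc l) = w t # factor w (Suc t) l"
  by (simp add: upt_conv_Cons del: upt_Suc)

lemma factor_Suc_right: "factor w t (Suc l) = factor w t l @ [w (t + l)]"
  by simp

text \<open>An occurrence of \<open>p\<close> other than the first possible one extends uniquely to the left, so
  counting the words \<open>p\<close>, \<open>0p\<close> and \<open>1p\<close> detects whether \<open>p\<close> is a prefix; extending to the
  right detects suffixes.\<close>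

lemma occurrences_extend:
  fixes w :: "nat \<Rightarrow> nat"
  assumes bin: "\<And>t. w t = 0 \<or> w t = 1" and p: "p \<noteq> []" "length p \<le> m"
  shows "occurrences p (factor w i m) =
           of_bool (factor w i (length p) = p) +
           (occurrences (0 # p) (factor w i m) + occurrences (1 # p) (factor w i m))"
    and "occurrences p (factor w i m) =
           of_bool (factor w (i + (m - length p)) (length p) = p) +
           (occurrences (p @ [0]) (factor w i m) + occurrences (p @ [1]) (factor w i m))"
proof -
  define l where "l = length p"
  \<comment> \<open>There are \<open>Suc M\<close> windows for \<open>p\<close> but only
    \<open>M\<close> for its one-letter extensions. The surplus window is the first for left
    extensions and the last for right ones, and it gives the indicator term.\<close>
  obtain M where M: "m + 1 - l = Suc M" "m - l = M" using p by (metis Suc_eq_plus1 Suc_diff_le l_def)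
  have left: "(of_bool (factor w t (Suc l) = 0 # p) + of_bool (factor w t (Suc l) = 1 # p) :: nat)
      = of_bool (factor w (Suc t) l = p)" for t
    using bin[of t] unfolding factor_Suc_left by auto
  have right: "(of_bool (factor w t (Suc l) = p @ [0]) + of_bool (factor w t (Suc l) = p @ [1]) :: nat)
      = of_bool (factor w t l = p)" for t
    using bin[of "t + l"] unfolding factor_Suc_right by auto
  have p_occ: "occurrences p (factor w i m) = (\<Sum>s<Suc M. of_bool (factor w (i + s) l = p))"
    using occurrences_factor[OF p(1), of w i m] M(1) unfolding l_def by (simp del: sum_of_bool_eq)
  have ext: "occurrences u (factor w i m) = (\<Sum>s<M. of_bool (factor w (i + s) (Suc l) = u))"
    if "length u = Suc l" for u
  proof -
    have "u \<noteq> []" "m + 1 - length u = M" using that M by auto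
    then show ?thesis using occurrences_factor[of u w i m] that by (simp del: sum_of_bool_eq)
  qed
  have cons: "occurrences (c # p) (factor w i m) = (\<Sum>s<M. of_bool (factor w (i + s) (Suc l) = c # p))"
    and snoc: "occurrences (p @ [c]) (factor w i m) = (\<Sum>s<M. of_bool (factor w (i + s) (Suc l) = p @ [c]))" for c
    by (simp_all add: ext l_def del: sum_of_bool_eq upt_Suc)
  show "occurrences p (factor w i m) =
           of_bool (factor w i (length p) = p) +
           (occurrences (0 # p) (factor w i m) + occurrences (1 # p) (factor w i m))"
    unfolding p_occ cons sum.distrib[symmetric] left sum.lessThan_Suc_shift
    by (simp only: l_def add_0_right add_Suc_right)
  show "occurrences p (factor w i m) =
           of_bool (factor w (i + (m - length p)) (length p) = p) +
           (occurrences (p @ [0]) (factor w i m) + occurrences (p @ [1]) (factor w i m))"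
    unfolding p_occ snoc sum.distrib[symmetric] right sum.lessThan_Suc
    using M(2) by (simp only: l_def add.commute)
qed

text \<open>A word of length k - 1 and its one-letter extensions are all short enough to be counted
  by the equivalence, so \<open>occurrences_extend\<close> forces the prefix and suffix indicators
  to agree. Since letters are 0 or 1, letter sums count the letter 1.\<close>

lemma k_abelian_equiv_factors:
  fixes w :: "nat \<Rightarrow> nat"
  assumes bin: "\<And>t. w t = 0 \<or> w t = 1" and k: "k \<ge> 1" "k - 1 \<le> m"
    and eq: "k_abelian_equiv k (factor w i m) (factor w j m)"
  shows "factor w i (k - 1) = factor w j (k - 1)"
    and "factor w (i + (m - (k - 1))) (k - 1) = factor w (j + (m - (k - 1))) (k - 1)"
    and "(\<Sum>s<m. w (i + s)) = (\<Sum>s<m. w (j + s))"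
proof -
  have occ: "occurrences u (factor w i m) = occurrences u (factor w j m)"
    if "u \<noteq> []" "length u \<le> k" for u
    using eq that by (auto simp: k_abelian_equiv_def)
  have len: "length (factor w t (k - 1)) = k - 1" for t by simp
  show "factor w i (k - 1) = factor w j (k - 1)"
  proof (cases "k = 1")
    case False
    let ?p = "factor w i (k - 1)"
    have p: "?p \<noteq> []" "length ?p \<le> m" using k False by auto
    note E = occurrences_extend(1)[where w = w and p = ?p and m = m, OF bin p, unfolded len]
    have ext: "occurrences (c # ?p) (factor w i m) = occurrences (c # ?p) (factor w j m)" for c
      using k by (intro occ) auto
    have "occurrences ?p (factor w i m) = occurrences ?p (factor w j m)"
      using p(1) by (intro occ) auto
    then have "(of_bool (factor w i (k - 1) = ?p) :: nat) = of_bool (factor w j (k - 1) = ?p)"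
      unfolding E[of i] E[of j] ext by (simp only: add_right_cancel)
    then have "factor w j (k - 1) = ?p" by (simp only: of_bool_eq_iff simp_thms)
    then show ?thesis ..
  qed auto
  show "factor w (i + (m - (k - 1))) (k - 1) = factor w (j + (m - (k - 1))) (k - 1)"
  proof (cases "k = 1")
    case False
    let ?p = "factor w (i + (m - (k - 1))) (k - 1)"
    have p: "?p \<noteq> []" "length ?p \<le> m" using k False by auto
    note E = occurrences_extend(2)[where w = w and p = ?p and m = m, OF bin p, unfolded len]
    have ext: "occurrences (?p @ [c]) (factor w i m) = occurrences (?p @ [c]) (factor w j m)" for c
      using k by (intro occ) auto
    have "occurrences ?p (factor w i m) = occurrences ?p (factor w j m)"
      using p(1) by (intro occ) auto
    then have "(of_bool (factor w (i + (m - (k - 1))) (k - 1) = ?p) :: nat) =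
        of_bool (factor w (j + (m - (k - 1))) (k - 1) = ?p)"
      unfolding E[of i] E[of j] ext by (simp only: add_right_cancel)
    then have "factor w (j + (m - (k - 1))) (k - 1) = ?p" by (simp only: of_bool_eq_iff simp_thms)
    then show ?thesis ..
  qed auto
  have sum: "occurrences [1] (factor w t m) = (\<Sum>s<m. w (t + s))" for t
  proof -
    have "occurrences [1] (factor w t m) = (\<Sum>s<m. of_bool (w (t + s) = 1))"
      by (simp add: occurrences_factor del: One_nat_def sum_of_bool_eq)
    also have "\<dots> = (\<Sum>s<m. w (t + s))"
    proof (rule sum.cong[OF refl])
      show "of_bool (w (t + s) = 1) = w (t + s)" for s
        using bin[of "t + s"] by auto
    qed
    finally show ?thesis .
  qed
  show "(\<Sum>s<m. w (i + s)) = (\<Sum>s<m. w (j + s))"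
    using occ[of "[1]"] k sum by simp
qed

lemma concat_blocks:
  assumes "\<forall>v\<in>set ws. length v = m" "concat ws = factor w i (length (concat ws))" "j < length ws"
  shows "ws ! j = factor w (i + j * m) m"
  using assms
proof (induction ws arbitrary: i j)
  case (Cons v ws)
  have "v @ concat ws = factor w i m @ factor w (i + m) (length (concat ws))"
    using Cons.prems(1,2) upt_add_eq_append[of i "i + m" "length (concat ws)"]
    by (simp add: add.assoc)
  then have *: "v = factor w i m" "concat ws = factor w (i + m) (length (concat ws))"
    using Cons.prems(1) by auto
  show ?case
  proof (cases j)
    case (Suc j')
    then show ?thesis
      using Cons.IH[OF _ *(2), of j'] Cons.prems by (simp add: algebra_simps)
  qed (use * in simp)
qed simp

lemma concat_factors: "concat (map (\<lambda>j. factor w (j * m) m) [0..<n]) = factor w 0 (n * m)"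
proof (induction n)
  case (Suc n)
  then show ?case using upt_add_eq_append[of 0 "n * m" m] by (simp add: add.commute)
qed simp

section \<open>Letters as differences of roundings\<close>

text \<open>Floors correspond to right-open codings, ceilings to left-open ones.\<close>

definition rounding :: "(real \<Rightarrow> int) \<Rightarrow> bool" where
  "rounding g \<longleftrightarrow> g = floor \<or> g = ceiling"

lemma rounding_add_int: "rounding g \<Longrightarrow> g (y + of_int c) = g y + c"
  by (auto simp: rounding_def)

text \<open>An integer strictly inside separates the floors because of strictness at a, and the
  ceilings because of strictness at b. Asking for both serves the two coding conventions at
  once.\<close>

lemma rounding_no_int_between:
  assumes "rounding g" "g a = g b"
  shows "\<not> (a < of_int r \<and> of_int r < b)"
proof
  assume "a < of_int r \<and> of_int r < b"
  then have "\<lfloor>a\<rfloor> < r" "r \<le> \<lfloor>b\<rfloor>" "\<lceil>a\<rceil> \<le> r" "r < \<lceil>b\<rceil>" by linarith+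
  then show False using assms by (auto simp: rounding_def)
qed

lemma frac_one_minus:
  fixes \<alpha> :: real
  assumes "\<alpha> \<notin> \<int>"
  shows "frac (1 - \<alpha>) = of_int \<lfloor>\<alpha>\<rfloor> + 1 - \<alpha>"
proof -
  have "\<alpha> \<noteq> of_int \<lfloor>\<alpha>\<rfloor>" using assms by (metis Ints_of_int)
  then have "\<lfloor>1 - \<alpha>\<rfloor> = - \<lfloor>\<alpha>\<rfloor>" by linarith
  then show ?thesis by (simp add: frac_def)
qed

text \<open>Adding \<alpha> raises the floor by either \<open>\<lfloor>\<alpha>\<rfloor>\<close> or
  one more, and the letter records which. In this form, letter sums over a factor telescope.\<close>

lemma right_open_letter:
  assumes "\<alpha> \<notin> \<int>"
  shows "int (sturmian_right_open \<alpha> x t) =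
    \<lfloor>x + real (Suc t) * \<alpha>\<rfloor> - \<lfloor>x + real t * \<alpha>\<rfloor> - \<lfloor>\<alpha>\<rfloor>"
proof -
  define y where "y = x + real t * \<alpha>"
  have y: "x + real (Suc t) * \<alpha> = y + \<alpha>" by (simp add: y_def algebra_simps)
  show ?thesis
  proof (cases "frac y < frac (1 - \<alpha>)")
    case True
    then have "\<lfloor>y + \<alpha>\<rfloor> = \<lfloor>y\<rfloor> + \<lfloor>\<alpha>\<rfloor>"
      unfolding frac_one_minus[OF assms] unfolding frac_def by (intro floor_unique) linarith+
    then show ?thesis using True unfolding sturmian_right_open_def y y_def[symmetric] by simp
  next
    case False
    then have "\<lfloor>y + \<alpha>\<rfloor> = \<lfloor>y\<rfloor> + \<lfloor>\<alpha>\<rfloor> + 1"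
      unfolding frac_one_minus[OF assms] unfolding frac_def by (intro floor_unique) (simp, linarith+)
    then show ?thesis using False unfolding sturmian_right_open_def y y_def[symmetric] by simp
  qed
qed

lemma left_open_letter:
  assumes "\<alpha> \<notin> \<int>"
  shows "int (sturmian_left_open \<alpha> x t) =
    \<lceil>x + real (Suc t) * \<alpha>\<rceil> - \<lceil>x + real t * \<alpha>\<rceil> - \<lfloor>\<alpha>\<rfloor>"
proof -
  define y where "y = x + real t * \<alpha>"
  have y: "x + real (Suc t) * \<alpha> = y + \<alpha>" by (simp add: y_def algebra_simps)
  have "of_int \<lfloor>\<alpha>\<rfloor> \<noteq> \<alpha>" using assms by (metis Ints_of_int)
  then have ne: "of_int \<lfloor>\<alpha>\<rfloor> < \<alpha>" by linarith
  show ?thesis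
  proof (cases "0 < frac y \<and> frac y \<le> frac (1 - \<alpha>)")
    case True
    then have pos: "of_int \<lfloor>y\<rfloor> < y" and le: "y - of_int \<lfloor>y\<rfloor> \<le> of_int \<lfloor>\<alpha>\<rfloor> + 1 - \<alpha>"
      unfolding frac_one_minus[OF assms] by (auto simp: frac_def)
    have "\<lceil>y\<rceil> = \<lfloor>y\<rfloor> + 1" using pos by linarith
    moreover have "\<lceil>y + \<alpha>\<rceil> = \<lfloor>y\<rfloor> + \<lfloor>\<alpha>\<rfloor> + 1"
      using pos le ne by (intro ceiling_unique) (simp, linarith+)
    ultimately show ?thesis using True unfolding sturmian_left_open_def y y_def[symmetric] by simp
  next
    case False
    have "\<lceil>y + \<alpha>\<rceil> = \<lceil>y\<rceil> + \<lfloor>\<alpha>\<rfloor> + 1"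
    \<comment> \<open>An integer y gets the letter 1 in the left-open coding, as the ceiling
      requires: any positive fractional part of \<alpha> already raises it.\<close>
    proof (cases "frac y = 0")
      case True
      then obtain r where "y = of_int r" by (auto elim: Ints_cases)
      then show ?thesis using ne by (intro ceiling_unique) (simp, linarith+)
    next
      case nz: False
      then have "0 < frac y" using frac_ge_0[of y] by linarith
      then have pos: "of_int \<lfloor>y\<rfloor> < y" and gt: "y - of_int \<lfloor>y\<rfloor> > of_int \<lfloor>\<alpha>\<rfloor> + 1 - \<alpha>"
        using False unfolding frac_one_minus[OF assms] by (auto simp: frac_def)
      have "\<lceil>y\<rceil> = \<lfloor>y\<rfloor> + 1" using pos by linarith
      then show ?thesis using gt by (intro ceiling_unique) (simp, linarith+)
    qed
    then show ?thesis using False unfolding sturmian_left_open_def y y_def[symmetric]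
      by (simp del: frac_gt_0_iff)
  qed
qed

lemma sturmian_word_rounding:
  assumes "sturmian_word \<alpha> w" "\<alpha> \<notin> \<int>"
  obtains g x where "rounding g"
    "\<And>t. int (w t) = g (x + real (Suc t) * \<alpha>) - g (x + real t * \<alpha>) - \<lfloor>\<alpha>\<rfloor>"
proof -
  obtain x where "w = sturmian_right_open \<alpha> x \<or> w = sturmian_left_open \<alpha> x"
    using assms(1) by (auto simp: sturmian_word_def)
  then show ?thesis
  proof
    assume "w = sturmian_right_open \<alpha> x"
    then show ?thesis using that[of floor x] right_open_letter[OF assms(2)] by (simp add: rounding_def)
  next
    assume "w = sturmian_left_open \<alpha> x"
    then show ?thesis using that[of ceiling x] left_open_letter[OF assms(2)] by (simp add: rounding_def)
  qed
qed

lemma sturmian_word_binary: "sturmian_word \<alpha> w \<Longrightarrow> w t = 0 \<or> w t = 1"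
  unfolding sturmian_word_def sturmian_right_open_def sturmian_left_open_def
  by (elim bexE disjE) simp_all

section \<open>Level intervals\<close>

lemma finite_level_points: "finite (level_points \<alpha> N)"
  by (simp add: level_points_def)

lemma finite_level_intervals: "finite (level_intervals \<alpha> N)"
  by (rule finite_subset[of _ "level_points \<alpha> N \<times> insert 1 (level_points \<alpha> N)"])
     (auto simp: level_intervals_def finite_level_points)

lemma level_points_bounds: "p \<in> level_points \<alpha> N \<Longrightarrow> 0 \<le> p \<and> p < 1"
  by (auto simp: level_points_def frac_lt_1)

lemma zero_level_point: "0 \<in> level_points \<alpha> N"
  by (force simp: level_points_def)

lemma level_interval_bounds:
  "(p, q) \<in> level_intervals \<alpha> N \<Longrightarrow> 0 \<le> p \<and> p < q \<and> q \<le> 1"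
  using level_points_bounds by (fastforce simp: level_intervals_def)

text \<open>Subtracting an endpoint amounts to moving a steps along the orbit, up to an integer. The
  extra endpoint 1 comes from a = 0.\<close>

lemma level_endpoint_shift:
  assumes "e \<in> insert 1 (level_points \<alpha> N)"
  obtains a c where "a \<le> N" "e = of_int c - real a * \<alpha>"
proof (cases "e = 1")
  case True
  then show ?thesis using that[of 0 1] by simp
next
  case False
  then obtain a where a: "a \<le> N" "e = frac (- (real a * \<alpha>))"
    using assms by (auto simp: level_points_def)
  then have "e = of_int (- \<lfloor>- (real a * \<alpha>)\<rfloor>) - real a * \<alpha>"
    by (simp add: frac_def)
  then show ?thesis using that a(1) by blast
qed

lemma level_point_intro:
  assumes "a \<le> N" "0 \<le> of_int r - real a * \<alpha>" "of_int r - real a * \<alpha> < 1"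
  shows "of_int r - real a * \<alpha> \<in> level_points \<alpha> N"
proof -
  have "frac (- (real a * \<alpha>)) = of_int r - real a * \<alpha>"
    using assms by (subst frac_unique_iff) auto
  then show ?thesis using assms(1) by (force simp: level_points_def)
qed

lemma level_interval_exists:
  assumes "0 \<le> y" "y < 1"
  obtains p q where "(p, q) \<in> level_intervals \<alpha> N" "p \<le> y" "y < q"
proof -
  define A where "A = {p \<in> level_points \<alpha> N. p \<le> y}"
  define B where "B = {q \<in> insert 1 (level_points \<alpha> N). y < q}"
  have fin: "finite A" "finite B" by (auto simp: A_def B_def finite_level_points)
  have ne: "A \<noteq> {}" "B \<noteq> {}" using assms zero_level_point by (auto simp: A_def B_def)
  have mem: "Max A \<in> A" "Min B \<in> B" using fin ne by auto
  have "{Max A<..<Min B} \<inter> level_points \<alpha> N = {}"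
  proof (rule ccontr)
    assume "\<not> ?thesis"
    then obtain r where r: "r \<in> level_points \<alpha> N" "Max A < r" "r < Min B" by auto
    then have "r \<notin> A" "r \<notin> B" using fin by (auto simp: not_le[symmetric])
    then show False using r(1) by (auto simp: A_def B_def)
  qed
  then show ?thesis using mem that[of "Max A" "Min B"] by (auto simp: A_def B_def level_intervals_def)
qed

lemma level_interval_no_point:
  assumes "(p, q) \<in> level_intervals \<alpha> N" "e \<in> level_points \<alpha> N"
  shows "e \<le> p \<or> q \<le> e"
proof -
  have "e \<notin> {p<..<q}" using assms by (auto simp: level_intervals_def)
  then show ?thesis by auto
qed

lemma level_interval_unique:
  assumes "(p, q) \<in> level_intervals \<alpha> N" "p \<le> y" "y < q"
    and "(p', q') \<in> level_intervals \<alpha> N" "p' \<le> y" "y < q'"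
  shows "(p, q) = (p', q')"
proof -
  have *: "b \<le> a \<and> d \<le> c"
    if "(a, c) \<in> level_intervals \<alpha> N" "a \<le> y" "y < c"
       "(b, d) \<in> level_intervals \<alpha> N" "b \<le> y" "y < d" for a b c d
  proof
    have "b \<in> level_points \<alpha> N" using that by (auto simp: level_intervals_def)
    then show "b \<le> a" using level_interval_no_point[OF that(1)] that by force
    show "d \<le> c"
    proof (cases "c = 1")
      case False
      then have "c \<in> level_points \<alpha> N" using that by (auto simp: level_intervals_def)
      then show ?thesis using level_interval_no_point[OF that(4)] that by force
    qed (use level_interval_bounds that in blast)
  qed
  show ?thesis using *[OF assms] *[OF assms(4-6) assms(1-3)] by simp
qed

lemma max_L_attained:
  obtains p q where "(p, q) \<in> level_intervals \<alpha> N" "max_L \<alpha> N = q - p"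
proof -
  have "level_intervals \<alpha> N \<noteq> {}"
    using level_interval_exists[of 0 \<alpha> N] by auto
  then have "max_L \<alpha> N \<in> (\<lambda>(p, q). q - p) ` level_intervals \<alpha> N"
    unfolding max_L_def by (intro Max_in) (auto simp: finite_level_intervals)
  then show ?thesis using that by auto
qed

lemma max_L_pos: "max_L \<alpha> N > 0"
  using max_L_attained[of \<alpha> N] level_interval_bounds by (metis diff_gt_0_iff_gt)

lemma max_L_0: "max_L \<alpha> 0 = 1"
proof -
  have "level_intervals \<alpha> 0 = {(0, 1)}"
    by (auto simp: level_intervals_def level_points_def)
  then show ?thesis by (simp add: max_L_def)
qed

text \<open>Shift by an integer the level interval around \<open>frac a\<close>. Its right end lies
  beyond a and, being a translate of a cut point, cannot fall before b. Only the open gap is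
  constrained, so a and b may be cut points themselves.\<close>

lemma gap_le_max_L:
  assumes "a < b" and gap: "\<And>i r. i \<le> N \<Longrightarrow> \<not> (a < of_int r - real i * \<alpha> \<and> of_int r - real i * \<alpha> < b)"
  shows "b - a \<le> max_L \<alpha> N"
proof -
  obtain p q where pq: "(p, q) \<in> level_intervals \<alpha> N" "p \<le> frac a" "frac a < q"
    using level_interval_exists[of "frac a" \<alpha> N] frac_lt_1 frac_ge_0 by blast
  have "q \<in> insert 1 (level_points \<alpha> N)" using pq(1) by (auto simp: level_intervals_def)
  then obtain i c where i: "i \<le> N" "q = of_int c - real i * \<alpha>"
    using level_endpoint_shift by blast
  have "b \<le> q + of_int \<lfloor>a\<rfloor>"
    using gap[OF i(1), of "c + \<lfloor>a\<rfloor>"] pq(3) i(2) by (auto simp: frac_def)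
  then have "b - a \<le> q - p" using pq(2) by (simp add: frac_def)
  also have "q - p \<le> max_L \<alpha> N"
    unfolding max_L_def
    by (rule Max_ge[OF finite_imageI[OF finite_level_intervals]]) (use pq(1) in force)
  finally show ?thesis .
qed

lemma floor_const_on_level_interval:
  assumes pq: "(p, q) \<in> level_intervals \<alpha> N" and y: "p \<le> y" "y < q" and i: "i \<le> N"
  shows "\<lfloor>y + real i * \<alpha>\<rfloor> = \<lfloor>p + real i * \<alpha>\<rfloor>"
proof (rule ccontr)
  assume "\<not> ?thesis"
  moreover have "\<lfloor>p + real i * \<alpha>\<rfloor> \<le> \<lfloor>y + real i * \<alpha>\<rfloor>" using y by (intro floor_mono) simp
  ultimately have less: "\<lfloor>p + real i * \<alpha>\<rfloor> < \<lfloor>y + real i * \<alpha>\<rfloor>" by simp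
  \<comment> \<open>This is the point where the floor last jumps on the way from p to y; it is an
    integer translate of -i\<alpha>, hence a cut point inside the interval.\<close>
  define e where "e = of_int \<lfloor>y + real i * \<alpha>\<rfloor> - real i * \<alpha>"
  have "p < e" "e \<le> y" using less unfolding e_def by linarith+
  moreover have "e \<in> level_points \<alpha> N"
    unfolding e_def using \<open>p < e\<close> \<open>e \<le> y\<close> y level_interval_bounds[OF pq] i
    by (intro level_point_intro) (auto simp: e_def)
  ultimately show False using level_interval_no_point[OF pq] y by force
qed

section \<open>Upper bound for exponents\<close>

lemma multiple_irrational_dist_pos:
  fixes \<alpha> :: real
  assumes "\<alpha> \<notin> \<rat>" "m \<ge> 1"
  shows "\<bar>real m * \<alpha> - of_int r\<bar> > 0"
proof -
  have "real m * \<alpha> \<noteq> of_int r"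
  proof
    assume "real m * \<alpha> = of_int r"
    then have "\<alpha> = of_int r / real m" using assms(2) by (simp add: field_simps)
    then show False using assms(1) by simp
  qed
  then show ?thesis by simp
qed

text \<open>Prefixes control the progression at the starts of blocks 0 to n - 1, suffixes at the
  ends, i.e. at indices 1 to n. Both apply to indices 1 to n - 1, which span n - 2 steps; this is
  the source of the summand 2.\<close>

lemma exponent_le:
  assumes irr: "\<alpha> \<notin> \<rat>" and k: "k \<ge> 1" and m: "m \<ge> k"
    and w: "sturmian_word \<alpha> w" and z: "k_abelian_power k m n z" "occurs_in z w"
  shows "real n \<le> max_L \<alpha> (2 * k - 2) / \<bar>real m * \<alpha> - of_int (round (real m * \<alpha>))\<bar> + 2"
proof (cases "n \<le> 2")
  case True
  have "0 \<le> max_L \<alpha> (2 * k - 2) / \<bar>real m * \<alpha> - of_int (round (real m * \<alpha>))\<bar>"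
    using max_L_pos[of \<alpha> "2 * k - 2"] by simp
  then show ?thesis using True by linarith
next
  case n: False
  let ?d = "\<bar>real m * \<alpha> - of_int (round (real m * \<alpha>))\<bar>"
  have "\<alpha> \<notin> \<int>" using irr Ints_subset_Rats by blast
  then obtain g x where g: "rounding g"
    and letter: "\<And>t. int (w t) = g (x + real (Suc t) * \<alpha>) - g (x + real t * \<alpha>) - \<lfloor>\<alpha>\<rfloor>"
    using sturmian_word_rounding[OF w] by blast
  note bin = sturmian_word_binary[OF w]
  have sum: "int (\<Sum>s<l. w (t + s)) = g (x + real (t + l) * \<alpha>) - g (x + real t * \<alpha>) - int l * \<lfloor>\<alpha>\<rfloor>" for t l
    by (induction l) (simp_all add: letter algebra_simps)
  obtain ws where ws: "length ws = n" "\<forall>v\<in>set ws. length v = m"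
    "\<And>v v'. v \<in> set ws \<Longrightarrow> v' \<in> set ws \<Longrightarrow> k_abelian_equiv k v v'" "z = concat ws"
    using z(1) unfolding k_abelian_power_def by blast
  obtain i0 where "z = factor w i0 (length z)"
    using z(2) by (auto simp: occurs_in_def)
  then have blocks: "ws ! j = factor w (i0 + j * m) m" if "j < n" for j
    using concat_blocks[OF ws(2)] ws(1,4) that by metis
  have equiv: "k_abelian_equiv k (factor w (i0 + j * m) m) (factor w (i0 + 0 * m) m)" if "j < n" for j
    using ws(3)[of "ws ! j" "ws ! 0"] that ws(1) unfolding blocks[OF that, symmetric]
    by (metis blocks nth_mem gr_implies_not0 not_gr_zero)
  have km: "k - 1 \<le> m" using m by simp
  note same = k_abelian_equiv_factors[OF bin k km equiv]
  define G where "G t = g (x + real t * \<alpha>)" for t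
  \<comment> \<open>The increment of \<open>G\<close> over the first block. Equal letter counts make
    it the increment over every block.\<close>
  define c where "c = G (i0 + m) - G i0"
  have G_diff: "G (t + l) - G t = int (\<Sum>s<l. w (t + s)) + int l * \<lfloor>\<alpha>\<rfloor>" for t l
    using sum[of t l] unfolding G_def by linarith
  have Gsum: "G (i0 + j * m + l) - G (i0 + j * m) = G (i0 + l) - G i0"
    if "(\<Sum>s<l. w (i0 + j * m + s)) = (\<Sum>s<l. w (i0 + 0 * m + s))" for j l
    using that by (simp add: G_diff)
  have step: "G (i0 + Suc j * m) - G (i0 + j * m) = c" if "j < n" for j
    using Gsum[OF same(3)[OF that]] unfolding c_def by (simp add: algebra_simps)
  have G: "G (i0 + j * m) = G i0 + int j * c" if "j \<le> n" for j
    using that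
  proof (induction j)
    case (Suc j)
    then show ?case using step[of j] by (simp add: algebra_simps)
  qed simp
  have prefix: "G (i0 + j * m + l) = G (i0 + l) + int j * c" if "j < n" "l \<le> k - 1" for j l
  proof -
    have "w (i0 + j * m + s) = w (i0 + 0 * m + s)" if "s < l" for s
      using arg_cong[OF same(1)[OF \<open>j < n\<close>], of "\<lambda>v. v ! s"] that \<open>l \<le> k - 1\<close> by simp
    then show ?thesis using Gsum[of j l] G[of j] that by simp
  qed
  have suffix: "G (i0 + Suc j * m - l) = G (i0 + m - l) + int j * c" if "j < n" "l \<le> k - 1" for j l
  proof -
    have "w (i0 + Suc j * m - l + s) = w (i0 + m - l + s)" if "s < l" for s
    proof -
      \<comment> \<open>The last l letters of a block sit at positions k - 1 - l onwards in its
        suffix of length k - 1.\<close>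
      define r where "r = k - 1 - l + s"
      have r: "r < k - 1" using that \<open>l \<le> k - 1\<close> by (simp add: r_def)
      have idx: "i0 + j * m + (m - (k - 1)) + r = i0 + Suc j * m - l + s" for j
        using \<open>l \<le> k - 1\<close> km by (simp add: r_def)
      have "factor w (i0 + j * m + (m - (k - 1))) (k - 1) ! r =
            factor w (i0 + 0 * m + (m - (k - 1))) (k - 1) ! r"
        by (simp only: same(2)[OF \<open>j < n\<close>])
      then show ?thesis unfolding nth_factor[OF r] idx by simp
    qed
    then have "(\<Sum>s<l. w (i0 + Suc j * m - l + s)) = (\<Sum>s<l. w (i0 + m - l + s))"
      by (intro sum.cong refl) (simp only: lessThan_iff)
    moreover have e: "i0 + Suc j * m - l + l = i0 + Suc j * m" "i0 + m - l + l = i0 + m"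
      using that(2) km by simp_all
    ultimately have "G (i0 + Suc j * m) - G (i0 + Suc j * m - l) = G (i0 + m) - G (i0 + m - l)"
      using G_diff[of "i0 + Suc j * m - l" l] G_diff[of "i0 + m - l" l] by (simp only: e)
    moreover have "G (i0 + Suc j * m) = G (i0 + m) + int j * c"
      using G[of "Suc j"] G[of 1] that by (simp add: algebra_simps)
    ultimately show ?thesis by simp
  qed
  define \<epsilon> where "\<epsilon> = real m * \<alpha> - of_int c"
  \<comment> \<open>The integer c is dictated by the word and may differ from the nearest one; that
    can only enlarge the step.\<close>
  have d: "?d \<le> \<bar>\<epsilon>\<bar>" unfolding \<epsilon>_def by (rule round_diff_minimal)
  have "?d > 0" using multiple_irrational_dist_pos[OF irr] m k by simp
  \<comment> \<open>Moving back by (k - 1)\<alpha> turns the offsets from -(k - 1) to k - 1 around a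
    block boundary into the level indices 0 to 2k - 2.\<close>
  define y where "y j = x + real i0 * \<alpha> - real (k - 1) * \<alpha> + real j * \<epsilon>" for j
  have const: "g (y j + real i * \<alpha>) = g (y 1 + real i * \<alpha>)" if "1 \<le> j" "j < n" "i \<le> 2 * k - 2" for j i
  proof (cases "i \<ge> k - 1")
    case True
    define l where "l = i - (k - 1)"
    have l: "l \<le> k - 1" "real i = real l + real (k - 1)" using that True by (auto simp: l_def)
    have "g (y j + real i * \<alpha>) = G (i0 + l)" if "j < n" for j
    proof -
      have "y j + real i * \<alpha> + of_int (int j * c) = x + real (i0 + j * m + l) * \<alpha>"
        unfolding y_def \<epsilon>_def l(2) by (simp add: algebra_simps)
      then show ?thesis using rounding_add_int[OF g, of "y j + real i * \<alpha>" "int j * c"]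
          prefix[OF that l(1)] unfolding G_def by simp
    qed
    then show ?thesis using that n by simp
  next
    case False
    define l where "l = k - 1 - i"
    have l: "l \<le> k - 1" "real i = real (k - 1) - real l" using that False by (auto simp: l_def)
    have "g (y (Suc j) + real i * \<alpha>) = G (i0 + m - l) - c" if "j < n" for j
    proof -
      have idx: "real (i0 + Suc j * m - l) = real i0 + real (Suc j) * real m - real l"
        using l(1) km by (subst of_nat_diff) (auto simp: algebra_simps)
      have "y (Suc j) + real i * \<alpha> + of_int (int (Suc j) * c) = x + real (i0 + Suc j * m - l) * \<alpha>"
        unfolding y_def \<epsilon>_def l(2) idx by (simp add: algebra_simps)
      then show ?thesis using rounding_add_int[OF g, of "y (Suc j) + real i * \<alpha>" "int (Suc j) * c"]
          suffix[OF that l(1)] unfolding G_def by (simp add: algebra_simps)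
    qed
    from this[of "j - 1"] this[of 0] show ?thesis using that n by simp
  qed
  have "\<bar>y (n - 1) - y 1\<bar> \<le> max_L \<alpha> (2 * k - 2)"
  proof -
    have gap: "b - a \<le> max_L \<alpha> (2 * k - 2)"
      if "a < b" "\<And>i. i \<le> 2 * k - 2 \<Longrightarrow> g (a + real i * \<alpha>) = g (b + real i * \<alpha>)" for a b
      using that(1)
    proof (rule gap_le_max_L)
      fix i r assume "i \<le> 2 * k - 2"
      from rounding_no_int_between[OF g that(2)[OF this], of r]
      show "\<not> (a < of_int r - real i * \<alpha> \<and> of_int r - real i * \<alpha> < b)" by auto
    qed
    have eq: "g (y (n - 1) + real i * \<alpha>) = g (y 1 + real i * \<alpha>)" if "i \<le> 2 * k - 2" for i
      using const[of "n - 1" i] that n by simp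
    consider "y 1 < y (n - 1)" | "y (n - 1) < y 1" | "y 1 = y (n - 1)" by linarith
    then show ?thesis
    proof cases
      case 1
      from gap[OF this] eq 1 show ?thesis by simp
    next
      case 2
      from gap[OF this] eq 2 show ?thesis by simp
    next
      case 3
      then show ?thesis using max_L_pos[of \<alpha> "2 * k - 2"] by simp
    qed
  qed
  moreover have "y (n - 1) - y 1 = (real n - 2) * \<epsilon>"
    using n by (simp add: y_def of_nat_diff algebra_simps)
  ultimately have "(real n - 2) * \<bar>\<epsilon>\<bar> \<le> max_L \<alpha> (2 * k - 2)"
    using n by (simp add: abs_mult)
  moreover have "(real n - 2) * ?d \<le> (real n - 2) * \<bar>\<epsilon>\<bar>"
    using d n by (intro mult_left_mono) auto
  ultimately show ?thesis using \<open>?d > 0\<close> by (simp add: field_simps)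
qed

section \<open>Lower bound for exponents\<close>

text \<open>The right-open coding lifted to the whole real line, which avoids fractional parts along
  an orbit.\<close>

definition rotation_letter :: "real \<Rightarrow> real \<Rightarrow> nat" where
  "rotation_letter \<alpha> y = nat (\<lfloor>y + \<alpha>\<rfloor> - \<lfloor>y\<rfloor> - \<lfloor>\<alpha>\<rfloor>)"

definition rotation_word :: "real \<Rightarrow> nat \<Rightarrow> real \<Rightarrow> nat list" where
  "rotation_word \<alpha> l y = map (\<lambda>i. rotation_letter \<alpha> (y + real i * \<alpha>)) [0..<l]"

lemma rotation_letter_add_int: "rotation_letter \<alpha> (y + of_int c) = rotation_letter \<alpha> y"
proof -
  have "\<lfloor>y + of_int c + \<alpha>\<rfloor> = \<lfloor>y + \<alpha>\<rfloor> + c"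
    by (simp only: floor_add_int add.assoc add.commute[of _ \<alpha>])
  then show ?thesis unfolding rotation_letter_def by simp
qed

lemma rotation_word_add_int: "rotation_word \<alpha> l (y + of_int c) = rotation_word \<alpha> l y"
proof -
  have "y + of_int c + real i * \<alpha> = (y + real i * \<alpha>) + of_int c" for i by simp
  then show ?thesis unfolding rotation_word_def by (simp only: rotation_letter_add_int)
qed

text \<open>A word of length l depends on the floors at the l + 1 indices 0 to l, and these jump
  only at level l points.\<close>

lemma rotation_word_const_on_level_interval:
  assumes "(p, q) \<in> level_intervals \<alpha> l" "p \<le> y" "y < q"
  shows "rotation_word \<alpha> l y = rotation_word \<alpha> l p"
proof -
  have "rotation_letter \<alpha> (y + real i * \<alpha>) = rotation_letter \<alpha> (p + real i * \<alpha>)" if "i < l" for i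
  proof -
    have *: "x + real i * \<alpha> + \<alpha> = x + real (Suc i) * \<alpha>" for x by (simp add: algebra_simps)
    have "\<lfloor>y + real i * \<alpha>\<rfloor> = \<lfloor>p + real i * \<alpha>\<rfloor>" "\<lfloor>y + real (Suc i) * \<alpha>\<rfloor> = \<lfloor>p + real (Suc i) * \<alpha>\<rfloor>"
      using that by (intro floor_const_on_level_interval[OF assms]; simp)+
    then show ?thesis unfolding rotation_letter_def * by simp
  qed
  then show ?thesis by (simp add: rotation_word_def)
qed

text \<open>The points coded by u form a union of level intervals, and
  \<open>\<lfloor>y - p\<rfloor> - \<lfloor>y - q\<rfloor>\<close> is the indicator of
  \<open>frac y\<close> lying in [p, q). Counting u along an orbit thus becomes a sum of
  floors.\<close>

lemma rotation_word_indicator: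
  "int (of_bool (rotation_word \<alpha> l y = u)) =
   (\<Sum>(p, q)\<in>{(p, q)\<in>level_intervals \<alpha> l. rotation_word \<alpha> l p = u}. \<lfloor>y - p\<rfloor> - \<lfloor>y - q\<rfloor>)"
proof -
  obtain p0 q0 where I: "(p0, q0) \<in> level_intervals \<alpha> l" "p0 \<le> frac y" "frac y < q0"
    using level_interval_exists[of "frac y" \<alpha> l] frac_lt_1 frac_ge_0 by blast
  let ?S = "{(p, q)\<in>level_intervals \<alpha> l. rotation_word \<alpha> l p = u}"
  have "rotation_word \<alpha> l y = rotation_word \<alpha> l (frac y)"
    using rotation_word_add_int[of \<alpha> l "frac y" "\<lfloor>y\<rfloor>"] by (simp add: frac_def)
  also have "\<dots> = rotation_word \<alpha> l p0" by (rule rotation_word_const_on_level_interval[OF I])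
  finally have word: "rotation_word \<alpha> l y = rotation_word \<alpha> l p0" .
  have "\<lfloor>y - p\<rfloor> - \<lfloor>y - q\<rfloor> = of_bool ((p, q) = (p0, q0))" if "(p, q) \<in> level_intervals \<alpha> l" for p q
  proof -
    note b = level_interval_bounds[OF that]
    have "\<lfloor>y - e\<rfloor> = \<lfloor>y\<rfloor> - of_bool (frac y < e)" if "0 \<le> e" "e \<le> 1" for e
    proof (cases "frac y < e")
      case True
      then have "\<lfloor>y - e\<rfloor> = \<lfloor>y\<rfloor> - 1"
        using that unfolding frac_def by (intro floor_unique) (simp, linarith+)
      then show ?thesis using True by simp
    next
      case False
      then have "\<lfloor>y - e\<rfloor> = \<lfloor>y\<rfloor>"
        using that unfolding frac_def by (intro floor_unique) linarith+
      then show ?thesis using False by simp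
    qed
    then have "\<lfloor>y - p\<rfloor> = \<lfloor>y\<rfloor> - of_bool (frac y < p)" "\<lfloor>y - q\<rfloor> = \<lfloor>y\<rfloor> - of_bool (frac y < q)"
      using b by simp_all
    then have "\<lfloor>y - p\<rfloor> - \<lfloor>y - q\<rfloor> = of_bool (p \<le> frac y \<and> frac y < q)"
      using b by (cases "frac y < p"; cases "frac y < q") simp_all
    moreover have "(p \<le> frac y \<and> frac y < q) = ((p, q) = (p0, q0))"
      using level_interval_unique[OF that _ _ I] I(2,3) by blast
    ultimately show ?thesis by (simp only:)
  qed
  note indicator = this
  have "(\<Sum>(p, q)\<in>?S. \<lfloor>y - p\<rfloor> - \<lfloor>y - q\<rfloor>) = (\<Sum>I\<in>?S. of_bool (I = (p0, q0)))"
  proof (rule sum.cong[OF refl])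
    fix I assume "I \<in> ?S"
    then show "(case I of (p, q) \<Rightarrow> \<lfloor>y - p\<rfloor> - \<lfloor>y - q\<rfloor>) = of_bool (I = (p0, q0))"
      using indicator[of "fst I" "snd I"] by (simp only: split_beta mem_Collect_eq prod.collapse)
  qed
  also have "\<dots> = of_bool ((p0, q0) \<in> ?S)"
  proof -
    have "finite ?S" by (rule finite_subset[OF _ finite_level_intervals[of \<alpha> l]]) auto
    then show ?thesis by (simp only: of_bool_def sum.delta)
  qed
  also have "(p0, q0) \<in> ?S \<longleftrightarrow> rotation_word \<alpha> l y = u" using I(1) word by simp
  finally show ?thesis by (simp only: of_nat_of_bool)
qed

text \<open>Endpoints of level \<open>l\<close> intervals are multiples \<open>-a\<alpha>\<close> with \<open>a \<le> l\<close>, so the sum of the floor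
  differences along an orbit telescopes to its first and last \<open>l\<close> terms.\<close>

lemma rotation_word_count_eq:
  assumes "l \<le> m"
    and first: "\<And>i. i < l \<Longrightarrow> \<lfloor>z + real i * \<alpha>\<rfloor> = \<lfloor>z' + real i * \<alpha>\<rfloor>"
    and last: "\<And>i. i \<le> m \<Longrightarrow> m < i + l \<Longrightarrow> \<lfloor>z + real i * \<alpha>\<rfloor> = \<lfloor>z' + real i * \<alpha>\<rfloor>"
  shows "(\<Sum>s<m + 1 - l. of_bool (rotation_word \<alpha> l (z + real s * \<alpha>) = u)) =
         (\<Sum>s<m + 1 - l. of_bool (rotation_word \<alpha> l (z' + real s * \<alpha>) = u) :: nat)"
proof -
  define M where "M = m + 1 - l"
  define D where "D i = \<lfloor>z + real i * \<alpha>\<rfloor> - \<lfloor>z' + real i * \<alpha>\<rfloor>" for i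
  \<comment> \<open>Sliding the window by one drops \<open>D a\<close> and gains
    \<open>D (M + a)\<close>; for a < l the hypotheses \<open>first\<close> and \<open>last\<close>
    make both vanish.\<close>
  have shift: "(\<Sum>s<M. D (s + a)) = (\<Sum>s<M. D s)" if "a \<le> l" for a
    using that
  proof (induction a)
    case (Suc a)
    have "(\<Sum>s<M. D (s + Suc a)) + D a = (\<Sum>s<Suc M. D (s + a))"
      by (simp add: sum.lessThan_Suc_shift del: sum.lessThan_Suc)
    also have "\<dots> = (\<Sum>s<M. D (s + a)) + D (M + a)" by simp
    finally have "(\<Sum>s<M. D (s + Suc a)) + D a = (\<Sum>s<M. D (s + a)) + D (M + a)" .
    moreover have "D a = 0" using first[of a] Suc.prems by (simp add: D_def)
    moreover have "D (M + a) = 0"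
      using last[of "M + a"] Suc.prems assms(1) by (simp add: D_def M_def)
    ultimately show ?case using Suc by simp
  qed simp
  have endpoint: "(\<Sum>s<M. \<lfloor>z + real s * \<alpha> - e\<rfloor> - \<lfloor>z' + real s * \<alpha> - e\<rfloor>) = (\<Sum>s<M. D s)"
    if e: "e \<in> insert 1 (level_points \<alpha> l)" for e
  proof -
    obtain a c where a: "a \<le> l" "e = of_int c - real a * \<alpha>"
      using level_endpoint_shift[OF e] by blast
    have "\<lfloor>y + real s * \<alpha> - e\<rfloor> = \<lfloor>y + real (s + a) * \<alpha>\<rfloor> - c" for y s
    proof -
      have "y + real s * \<alpha> - e = y + real (s + a) * \<alpha> - of_int c"
        unfolding a(2) by (simp add: algebra_simps)
      then show ?thesis by (simp only: floor_diff_of_int)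
    qed
    then show ?thesis using shift[OF a(1)] by (simp add: D_def)
  qed
  let ?S = "{(p, q)\<in>level_intervals \<alpha> l. rotation_word \<alpha> l p = u}"
  have "int (\<Sum>s<M. of_bool (rotation_word \<alpha> l (z + real s * \<alpha>) = u)) -
        int (\<Sum>s<M. of_bool (rotation_word \<alpha> l (z' + real s * \<alpha>) = u)) =
        (\<Sum>s<M. \<Sum>(p, q)\<in>?S. (\<lfloor>z + real s * \<alpha> - p\<rfloor> - \<lfloor>z' + real s * \<alpha> - p\<rfloor>) -
                             (\<lfloor>z + real s * \<alpha> - q\<rfloor> - \<lfloor>z' + real s * \<alpha> - q\<rfloor>))"
    unfolding of_nat_sum rotation_word_indicator sum_subtractf[symmetric]
    by (intro sum.cong refl) auto
  also have "\<dots> = (\<Sum>(p, q)\<in>?S.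
      (\<Sum>s<M. \<lfloor>z + real s * \<alpha> - p\<rfloor> - \<lfloor>z' + real s * \<alpha> - p\<rfloor>) -
      (\<Sum>s<M. \<lfloor>z + real s * \<alpha> - q\<rfloor> - \<lfloor>z' + real s * \<alpha> - q\<rfloor>))"
    by (subst sum.swap) (intro sum.cong refl, auto simp: sum_subtractf)
  \<comment> \<open>Every endpoint contributes the same total, so the two ends of each interval
    cancel.\<close>
  also have "\<dots> = 0"
    by (intro sum.neutral) (auto simp: endpoint level_intervals_def)
  finally show ?thesis unfolding M_def by linarith
qed

text \<open>A progression of n + 1 points fits inside a longest level interval, where all the
  relevant floors are constant. The extra point is needed because the end of block j is read off
  from \<open>y (Suc j)\<close>.\<close>

lemma exponent_attained:
  assumes irr: "\<alpha> \<notin> \<int>" and k: "k \<ge> 1"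
    and n: "real n * \<bar>real m * \<alpha> - of_int c\<bar> < max_L \<alpha> (2 * k - 2)"
  shows "\<exists>w z. sturmian_word \<alpha> w \<and> k_abelian_power k m n z \<and> occurs_in z w"
proof -
  obtain P Q where PQ: "(P, Q) \<in> level_intervals \<alpha> (2 * k - 2)" "max_L \<alpha> (2 * k - 2) = Q - P"
    by (rule max_L_attained)
  define \<epsilon> where "\<epsilon> = real m * \<alpha> - of_int c"
  \<comment> \<open>Centred at the midpoint, the progression strays by at most n/2 steps to either
    side, which is less than half the interval.\<close>
  define y where "y j = (P + Q) / 2 + (real j - real n / 2) * \<epsilon>" for j
  define z where "z j = y j + real (k - 1) * \<alpha>" for j
  have y: "P \<le> y j \<and> y j < Q" if "j \<le> n" for j
  proof -
    have "\<bar>(real j - real n / 2) * \<epsilon>\<bar> \<le> real n / 2 * \<bar>\<epsilon>\<bar>"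
      unfolding abs_mult using that by (intro mult_right_mono) (auto simp: abs_if)
    also have "\<dots> < (Q - P) / 2" using n PQ(2) by (simp add: \<epsilon>_def)
    finally have "\<bar>(real j - real n / 2) * \<epsilon>\<bar> < (Q - P) / 2" .
    then show ?thesis unfolding y_def by (auto simp: abs_less_iff field_simps)
  qed
  have const: "\<lfloor>y j + real i * \<alpha>\<rfloor> = \<lfloor>P + real i * \<alpha>\<rfloor>" if "j \<le> n" "i \<le> 2 * k - 2" for i j
    using floor_const_on_level_interval[OF PQ(1)] y[OF that(1)] that(2) by blast
  have next_z: "z j + real m * \<alpha> = z (Suc j) + of_int c" for j
    by (simp add: z_def y_def \<epsilon>_def algebra_simps)
  have z_j: "z 0 + real (j * m) * \<alpha> = z j + of_int (int j * c)" for j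
    by (simp add: z_def y_def \<epsilon>_def algebra_simps)
  define w where "w = sturmian_right_open \<alpha> (frac (z 0))"
  have letter: "w t = rotation_letter \<alpha> (z 0 + real t * \<alpha>)" for t
  proof -
    have "z 0 + real t * \<alpha> = frac (z 0) + real t * \<alpha> + of_int \<lfloor>z 0\<rfloor>" by (simp add: frac_def)
    then have "rotation_letter \<alpha> (z 0 + real t * \<alpha>) = rotation_letter \<alpha> (frac (z 0) + real t * \<alpha>)"
      by (simp only: rotation_letter_add_int)
    also have "\<dots> = nat (int (w t))"
      unfolding w_def right_open_letter[OF irr] rotation_letter_def by (simp add: algebra_simps)
    finally show ?thesis by simp
  qed
  have fac: "factor w (j * m + s) l = rotation_word \<alpha> l (z j + real s * \<alpha>)" for j s l
  proof -
    have "w (j * m + s + i) = rotation_letter \<alpha> (z j + real s * \<alpha> + real i * \<alpha>)" for i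
    proof -
      have "z 0 + real (j * m + s + i) * \<alpha> = z 0 + real (j * m) * \<alpha> + real s * \<alpha> + real i * \<alpha>"
        by (simp add: algebra_simps)
      also have "\<dots> = z j + real s * \<alpha> + real i * \<alpha> + of_int (int j * c)"
        unfolding z_j by simp
      finally show ?thesis unfolding letter by (simp only: rotation_letter_add_int)
    qed
    then show ?thesis unfolding rotation_word_def by (intro nth_equalityI) auto
  qed
  have equiv: "occurrences u (factor w (j * m) m) = occurrences u (factor w (0 * m) m)"
    if "j < n" and u: "u \<noteq> []" "length u \<le> k" for u j
  proof (cases "length u \<le> m")
    case True
    have "\<lfloor>z j + real i * \<alpha>\<rfloor> = \<lfloor>P + real (k - 1 + i) * \<alpha>\<rfloor>" if "j < n" "i < length u" for i j
    proof -
      have "z j + real i * \<alpha> = y j + real (k - 1 + i) * \<alpha>" by (simp add: z_def algebra_simps)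
      then show ?thesis using const[of j "k - 1 + i"] that u k by simp
    qed
    then have first: "\<lfloor>z j + real i * \<alpha>\<rfloor> = \<lfloor>z 0 + real i * \<alpha>\<rfloor>" if "i < length u" for i
      using that \<open>j < n\<close> by simp
    \<comment> \<open>Positions near the end of block j are viewed backwards from the start of block
      j + 1. As m - i < \<open>length u\<close> and \<open>length u\<close> is at most k, the
      subtraction does not truncate.\<close>
    have "\<lfloor>z j + real i * \<alpha>\<rfloor> = \<lfloor>P + real (k - 1 - (m - i)) * \<alpha>\<rfloor> + c"
      if "j < n" "i \<le> m" "m < i + length u" for i j
    proof -
      have "real (k - 1 - (m - i)) = real (k - 1) - (real m - real i)"
        using that u k by (subst of_nat_diff) auto
      then have "y (Suc j) + real (k - 1 - (m - i)) * \<alpha> + of_int c =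
          z (Suc j) + of_int c - (real m - real i) * \<alpha>"
        unfolding z_def by (simp only: left_diff_distrib)
      also have "\<dots> = z j + real i * \<alpha>"
        unfolding next_z[symmetric] by (simp only: left_diff_distrib)
      finally have "z j + real i * \<alpha> = y (Suc j) + real (k - 1 - (m - i)) * \<alpha> + of_int c" ..
      then show ?thesis using const[of "Suc j" "k - 1 - (m - i)"] that by simp
    qed
    then have last: "\<lfloor>z j + real i * \<alpha>\<rfloor> = \<lfloor>z 0 + real i * \<alpha>\<rfloor>" if "i \<le> m" "m < i + length u" for i
      using that \<open>j < n\<close> by simp
    show ?thesis
      unfolding occurrences_factor[OF u(1)] fac
      by (rule rotation_word_count_eq[OF True first last])
  \<comment> \<open>Words longer than the period occur in no block.\<close>
  next
    case False
    then show ?thesis by (simp add: occurrences_def)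
  qed
  define ws where "ws = map (\<lambda>j. factor w (j * m) m) [0..<n]"
  have "k_abelian_equiv k v v'" if "v \<in> set ws" "v' \<in> set ws" for v v'
    using that equiv unfolding ws_def k_abelian_equiv_def by fastforce
  then have "k_abelian_power k m n (concat ws)"
    unfolding k_abelian_power_def by (intro exI[of _ ws]) (auto simp: ws_def)
  moreover have "occurs_in (concat ws) w"
    unfolding occurs_in_def ws_def concat_factors by (intro exI[of _ 0]) simp
  moreover have "sturmian_word \<alpha> w"
    unfolding sturmian_word_def w_def by (intro bexI[of _ "frac (z 0)"]) (auto simp: frac_lt_1)
  ultimately show ?thesis by blast
qed

section \<open>The critical exponent\<close>

text \<open>The limit superior on the right does not involve k, so comparing with k = 1, where the
  factor is 1, gives the theorem.\<close>

lemma abelian_critical_exponent_eq: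
  assumes irr: "\<alpha> \<notin> \<rat>" and k: "k \<ge> 1"
  shows "abelian_critical_exponent k \<alpha> = ereal (max_L \<alpha> (2 * k - 2)) *
    limsup (\<lambda>m. ereal (1 / (real m * \<bar>real m * \<alpha> - of_int (round (real m * \<alpha>))\<bar>)))"
proof -
  define L where "L = max_L \<alpha> (2 * k - 2)"
  define d where "d m = \<bar>real m * \<alpha> - of_int (round (real m * \<alpha>))\<bar>" for m
  define h where "h m = 1 / (real m * d m)" for m
  have L: "L > 0" by (simp add: L_def max_L_pos)
  have d: "d m > 0" if "m \<ge> 1" for m
    using multiple_irrational_dist_pos[OF irr that] by (simp add: d_def)
  have upper: "ereal_of_enat (ab k \<alpha> m) / ereal (real m) \<le> ereal (2 / real m) + ereal (L * h m)"
    if "m \<ge> k" for m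
  proof -
    have m: "m > 0" using that k by simp
    have "ab k \<alpha> m \<le> enat (nat \<lfloor>L / d m + 2\<rfloor>)"
      unfolding ab_def
    proof (rule SUP_least)
      fix n assume "n \<in> {n. \<exists>w z. sturmian_word \<alpha> w \<and> k_abelian_power k m n z \<and> occurs_in z w}"
      then have "real n \<le> L / d m + 2"
        using exponent_le[OF irr k that] unfolding L_def d_def by blast
      then show "enat n \<le> enat (nat \<lfloor>L / d m + 2\<rfloor>)" by (simp only: enat_ord_simps le_nat_floor)
    qed
    then have "ereal_of_enat (ab k \<alpha> m) \<le> ereal_of_enat (enat (nat \<lfloor>L / d m + 2\<rfloor>))"
      by (simp only: ereal_of_enat_le_iff)
    also have "\<dots> \<le> ereal (L / d m + 2)"
      using L d[of m] m by simp
    finally have "ereal_of_enat (ab k \<alpha> m) / ereal (real m) \<le> ereal (L / d m + 2) / ereal (real m)"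
      using m by (intro ereal_divide_right_mono) auto
    also have "\<dots> = ereal (2 / real m) + ereal (L * h m)"
      using m d[of m] by (simp add: h_def field_simps)
    finally show ?thesis .
  qed
  have lower: "ereal (- (1 / real m)) + ereal (L * h m) \<le> ereal_of_enat (ab k \<alpha> m) / ereal (real m)"
    if "m \<ge> k" for m
  proof -
    have m: "m > 0" using that k by simp
    \<comment> \<open>The largest integer strictly below L / d m, since
      \<open>exponent_attained\<close> asks for a strict inequality.\<close>
    define n where "n = nat (\<lceil>L / d m\<rceil> - 1)"
    have "L / d m > 0" using L d[of m] m by simp
    then have n: "real n < L / d m" "real n \<ge> L / d m - 1" unfolding n_def by linarith+
    then have "real n * d m < L" using d[of m] m by (simp add: field_simps)
    then have "n \<in> {n. \<exists>w z. sturmian_word \<alpha> w \<and> k_abelian_power k m n z \<and> occurs_in z w}"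
      using exponent_attained[OF _ k, of \<alpha> n m] irr Ints_subset_Rats unfolding L_def d_def by blast
    then have "enat n \<le> ab k \<alpha> m" unfolding ab_def by (rule SUP_upper)
    then have "ereal_of_enat (enat n) \<le> ereal_of_enat (ab k \<alpha> m)"
      by (simp only: ereal_of_enat_le_iff)
    then have "ereal (L / d m - 1) \<le> ereal_of_enat (ab k \<alpha> m)"
      using n(2) by (metis dual_order.trans ereal_less_eq(3) ereal_of_enat_simps(1))
    then have "ereal (L / d m - 1) / ereal (real m) \<le> ereal_of_enat (ab k \<alpha> m) / ereal (real m)"
      using m by (intro ereal_divide_right_mono) auto
    moreover have "ereal (L / d m - 1) / ereal (real m) = ereal (- (1 / real m)) + ereal (L * h m)"
      using m d[of m] by (simp add: h_def field_simps)
    ultimately show ?thesis by simp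
  qed
  \<comment> \<open>Absorbs the errors 2/m and -1/m of the two bounds.\<close>
  have limsup_shift: "limsup (\<lambda>m. ereal (c / real m) + ereal (L * h m)) = limsup (\<lambda>m. ereal (L * h m))" for c
  proof -
    have "(\<lambda>m. ereal (c / real m)) \<longlonglongrightarrow> ereal 0"
      by (intro tendsto_ereal lim_const_over_n)
    then show ?thesis by (subst ereal_limsup_lim_add[where a = 0]) (auto simp: zero_ereal_def)
  qed
  have "abelian_critical_exponent k \<alpha> = limsup (\<lambda>m. ereal (L * h m))"
  proof (rule antisym)
    show "abelian_critical_exponent k \<alpha> \<le> limsup (\<lambda>m. ereal (L * h m))"
      unfolding abelian_critical_exponent_def limsup_shift[of 2, symmetric]
      by (rule Limsup_mono, rule eventually_sequentiallyI[of k]) (rule upper)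
    show "limsup (\<lambda>m. ereal (L * h m)) \<le> abelian_critical_exponent k \<alpha>"
      unfolding abelian_critical_exponent_def limsup_shift[of "-1", symmetric]
      by (rule Limsup_mono, rule eventually_sequentiallyI[of k]) (use lower in simp)
  qed
  also have "\<dots> = limsup (\<lambda>m. ereal L * ereal (h m))" by simp
  \<comment> \<open>As L is positive and finite, it can be pulled out even if the limit superior is
    infinite.\<close>
  also have "\<dots> = ereal L * limsup (\<lambda>m. ereal (h m))"
    using L by (intro Limsup_ereal_mult_left) auto
  finally show ?thesis unfolding L_def h_def d_def .
qed

theorem theorem3p12:
  fixes \<alpha> :: real and k :: nat
  assumes "\<alpha> \<notin> \<rat>" and "k \<ge> 1"
  shows "abelian_critical_exponent k \<alpha> =
         ereal (max_L \<alpha> (2 * k - 2)) * abelian_critical_exponent 1 \<alpha>"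
  using abelian_critical_exponent_eq[OF assms] abelian_critical_exponent_eq[OF assms(1), of 1]
  by (simp add: max_L_0 one_ereal_def[symmetric])

end
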